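(* Let $m\ge1$ and let $\mathbf r(t)=\sum_{i=0}^{2m+5}\mathbf r_iN^3_{i,\rho}(t)$, $t\in[t_1,t_{m+2}]$, be a closed cubic Pythagorean-Hodograph B-spline curve with the data $\mathbf z_k,d_k,\mathbf p_k,\sigma_k,\mathbf r_k$ described in the context, with $\mathbf z(t)\ne0$ on $[t_1,t_{m+2}]$. Let $\tau=\{\langle t_{-1}\rangle^3<\langle t_0\rangle^5<\langle t_1\rangle^5<\dots<\langle t_{m+3}\rangle^5<\langle t_{m+4}\rangle^3\}$. Then for every $h\in\mathbb R$ the offset curve $\mathbf r_h=\mathbf r-\mathrm i h\,\mathbf r'/|\mathbf r'|$ equals $$\mathbf r_h(t)=\frac{\sum_{k=0}^{5m+19}\mathbf q_kN^5_{k,\tau}(t)}{\sum_{k=0}^{5m+19}\gamma_kN^5_{k,\tau}(t)},\quad t\in[t_1,t_{m+2}],$$ with the following weights and control points, where $\mathbf c_k=\frac{d_{k+2}}{d_{k+1}+d_{k+2}}\mathbf r_{2k+1}+\frac{d_{k+1}}{d_{k+1}+d_{k+2}}\mathbf r_{2k+2}$ for $0\le k\le m+1$. $\gamma_k=0$ and $\mathbf q_k=0$ for $0\le k\le3$ and for $5m+16\le k\le5m+19$; $\gamma_4=\frac{d_0}{10(d_0+d_1)}\sigma_1$, $\gamma_5=\frac3{10}\sigma_1$, $\gamma_6=\frac35\sigma_1$, $\gamma_{5m+13}=\frac35\sigma_{2m+3}$, $\gamma_{5m+14}=\frac3{10}\sigma_{2m+3}$, $\gamma_{5m+15}=\frac{d_{m+4}}{10(d_{m+3}+d_{m+4})}\sigma_{2m+3}$;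 $\mathbf q_4=\frac{d_0}{10(d_0+d_1)}(\mathbf r_0\sigma_1-\mathrm i h\mathbf p_1)$, $\mathbf q_5=\frac3{10}(\mathbf r_0\sigma_1-\mathrm i h\mathbf p_1)$, $\mathbf q_6=\frac35(\mathbf r_1\sigma_1-\mathrm i h\mathbf p_1)$, $\mathbf q_{5m+13}=\frac35(\mathbf r_{2m+4}\sigma_{2m+3}-\mathrm i h\mathbf p_{2m+3})$, $\mathbf q_{5m+14}=\frac3{10}(\mathbf r_{2m+5}\sigma_{2m+3}-\mathrm i h\mathbf p_{2m+3})$, $\mathbf q_{5m+15}=\frac{d_{m+4}}{10(d_{m+3}+d_{m+4})}(\mathbf r_{2m+5}\sigma_{2m+3}-\mathrm i h\mathbf p_{2m+3})$; $\gamma_{5k+7}=\sigma_{2k+1}$ and $\mathbf q_{5k+7}=\mathbf c_k\sigma_{2k+1}-\mathrm i h\mathbf p_{2k+1}$ for $0\le k\le m+1$; and for $0\le k\le m$ $$\gamma_{5k+8}=\tfrac35\sigma_{2k+1}+\tfrac25\sigma_{2k+2},\quad \gamma_{5k+9}=\tfrac3{10}\sigma_{2k+1}+\tfrac35\sigma_{2k+2}+\tfrac1{10}\sigma_{2k+3},$$ $$\gamma_{5k+10}=\tfrac1{10}\sigma_{2k+1}+\tfrac35\sigma_{2k+2}+\tfrac3{10}\sigma_{2k+3},\quad \gamma_{5k+11}=\tfrac25\sigma_{2k+2}+\tfrac35\sigma_{2k+3},$$ $$\mathbf q_{5k+8}=\tfrac35\mathbf r_{2k+2}\sigma_{2k+1}+\tfrac25\mathbf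 c_k\sigma_{2k+2}-\mathrm i h(\tfrac35\mathbf p_{2k+1}+\tfrac25\mathbf p_{2k+2}),$$ $$\mathbf q_{5k+9}=\tfrac3{10}\mathbf r_{2k+3}\sigma_{2k+1}+\tfrac35\mathbf r_{2k+2}\sigma_{2k+2}+\tfrac1{10}\mathbf c_k\sigma_{2k+3}-\mathrm i h(\tfrac3{10}\mathbf p_{2k+1}+\tfrac35\mathbf p_{2k+2}+\tfrac1{10}\mathbf p_{2k+3}),$$ $$\mathbf q_{5k+10}=\tfrac1{10}\mathbf c_{k+1}\sigma_{2k+1}+\tfrac35\mathbf r_{2k+3}\sigma_{2k+2}+\tfrac3{10}\mathbf r_{2k+2}\sigma_{2k+3}-\mathrm i h(\tfrac1{10}\mathbf p_{2k+1}+\tfrac35\mathbf p_{2k+2}+\tfrac3{10}\mathbf p_{2k+3}),$$ $$\mathbf q_{5k+11}=\tfrac25\mathbf c_{k+1}\sigma_{2k+2}+\tfrac35\mathbf r_{2k+3}\sigma_{2k+3}-\mathrm i h(\tfrac25\mathbf p_{2k+2}+\tfrac35\mathbf p_{2k+3}).$$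
   Context: Normalized B-splines: for a nondecreasing knot sequence $\mu=\{t_i\}$, $N^0_{i,\mu}(t)=1$ if $t\in[t_i,t_{i+1})$ and $0$ otherwise, and $N^n_{i,\mu}(t)=\frac{t-t_i}{t_{i+n}-t_i}N^{n-1}_{i,\mu}(t)+\frac{t_{i+n+1}-t}{t_{i+n+1}-t_{i+1}}N^{n-1}_{i+1,\mu}(t)$ with $0/0=0$; indexing starts at $0$. $\langle t\rangle^k$ denotes the knot $t$ repeated $k$ times. Points of $\mathbb R^2$ are identified with complex numbers. Data: $t_{-1}<0=t_0<t_1<\dots<t_{m+3}<t_{m+4}$, $d_k=t_k-t_{k-1}$, with $d_{m+2}=d_1$, $d_{m+3}=d_2$; $\mathbf z_0,\dots,\mathbf z_{m+1}\in\mathbb C$, $\mu=\{t_0,\dots,t_{m+3}\}$, $\mathbf z(t)=\sum_{i=0}^{m+1}\mathbf z_iN^1_{i,\mu}(t)$; $\nu=\{s_i\}=\{\langle t_0\rangle^2<\dots<\langle t_{m+3}\rangle^2\}$, $\rho=\{t_{-1}<\langle t_0\rangle^2<\dots<\langle t_{m+3}\rangle^2<t_{m+4}\}$. $\mathbf p_0=\mathbf p_{2m+4}=0$, $\sigma_0=\sigma_{2m+4}=0$; $\mathbf p_{2k+1}=\mathbf z_k^2$, $\sigma_{2k+1}=\mathbf z_k\bar{\mathbf z}_k$ ($0\le k\le m+1$); $\mathbf p_{2k+2}=\mathbf z_k\mathbf z_{k+1}$, $\sigma_{2k+2}=\frac12(\mathbf z_k\bar{\mathbf z}_{k+1}+\mathbf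 z_{k+1}\bar{\mathbf z}_k)$ ($0\le k\le m$). The closing conditions $\sum_{j=2-k}^{2m+3-k}(s_{j+3}-s_j)\mathbf p_j=0$, $k=0,1$, hold. $\mathbf r_0$ is arbitrary, $\mathbf r_1=\mathbf r_0$, $\mathbf r_{2i+2}=\mathbf r_{2i+1}+\frac{d_{i+1}+d_{i+2}}3\mathbf z_i^2$ ($0\le i\le m+1$), $\mathbf r_{2i+3}=\mathbf r_{2i+2}+\frac{d_{i+2}}3\mathbf z_i\mathbf z_{i+1}$ ($0\le i\le m$), $\mathbf r_{2m+5}=\mathbf r_{2m+4}$; one has $\mathbf r'=\mathbf z^2$ on $[t_1,t_{m+2}]$. *)

theory Defs
  imports "HOL-Analysis.Analysis"
begin

text \<open>
  Normalized B-splines over a finite nondecreasing knot sequence given as a list, indexed from 0.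
  \<^term>\<open>bspline \<kappa> n i\<close> only inspects the knots \<open>\<kappa> ! i, \<dots>, \<kappa> ! (i + n + 1)\<close>. The convention
  \<open>0/0 = 0\<close> is HOL's \<open>x / 0 = 0\<close>: a coefficient with vanishing denominator always multiplies
  a lower-degree B-spline that is identically zero.
\<close>

fun bspline :: "real list \<Rightarrow> nat \<Rightarrow> nat \<Rightarrow> real \<Rightarrow> real" where
  "bspline \<kappa> 0 i u = (if \<kappa> ! i \<le> u \<and> u < \<kappa> ! (i + 1) then 1 else 0)"
| "bspline \<kappa> (Suc n) i u =
     (u - \<kappa> ! i) / (\<kappa> ! (i + Suc n) - \<kappa> ! i) * bspline \<kappa> n i u
   + (\<kappa> ! (i + Suc n + 1) - u) / (\<kappa> ! (i + Suc n + 1) - \<kappa> ! (i + 1)) * bspline \<kappa> n (i + 1) u"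

definition bspline_curve ::
    "real list \<Rightarrow> nat \<Rightarrow> nat \<Rightarrow> (nat \<Rightarrow> 'a::real_vector) \<Rightarrow> real \<Rightarrow> 'a" where
  "bspline_curve \<kappa> n N c u = (\<Sum>i=0..N. bspline \<kappa> n i u *\<^sub>R c i)"

text \<open>The knots \<open>t\<^sub>0, \<dots>, t\<^sub>m\<^sub>+\<^sub>3\<close>, each repeated \<open>l\<close> times; \<open>t\<close> is indexed by integers because
  of the additional knot \<open>t\<^sub>-\<^sub>1\<close>.\<close>

definition rep_knots :: "nat \<Rightarrow> nat \<Rightarrow> (int \<Rightarrow> real) \<Rightarrow> real list" where
  "rep_knots l m t = concat (map (\<lambda>k. replicate l (t (int k))) [0..<m + 4])"

definition mu_knots :: "nat \<Rightarrow> (int \<Rightarrow> real) \<Rightarrow> real list" where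
  "mu_knots m t = rep_knots 1 m t"

definition nu_knots :: "nat \<Rightarrow> (int \<Rightarrow> real) \<Rightarrow> real list" where
  "nu_knots m t = rep_knots 2 m t"

definition rho_knots :: "nat \<Rightarrow> (int \<Rightarrow> real) \<Rightarrow> real list" where
  "rho_knots m t = [t (-1)] @ rep_knots 2 m t @ [t (int m + 4)]"

definition tau_knots :: "nat \<Rightarrow> (int \<Rightarrow> real) \<Rightarrow> real list" where
  "tau_knots m t = replicate 3 (t (-1)) @ rep_knots 5 m t @ replicate 3 (t (int m + 4))"

text \<open>The offset at distance \<open>h\<close> of a plane curve defined on \<open>S\<close>; the derivative is taken within
  \<open>S\<close>, hence one-sided at the endpoints of an interval.\<close>

definition offset_curve :: "real set \<Rightarrow> (real \<Rightarrow> complex) \<Rightarrow> real \<Rightarrow> real \<Rightarrow> complex" where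
  "offset_curve S r h u =
     (let r' = vector_derivative r (at u within S)
      in r u - \<i> * of_real h * (r' / of_real (cmod r')))"

end

theory Submission
  imports Defs
begin

text \<open>
  On each cell \<open>[t\<^sub>k\<^sub>+\<^sub>1, t\<^sub>k\<^sub>+\<^sub>2]\<close> every spline involved is a polynomial in Bezier form: the knots of
  \<open>\<mu>\<close> and \<open>\<tau>\<close> have multiplicity equal to the degree, so the nonzero B-splines are the Bernstein
  polynomials, and for \<open>\<rho>\<close> one step of the recursion turns the de Boor points
  into the control points \<open>c k\<close>, \<open>r (2k + 2)\<close>, \<open>r (2k + 3)\<close>, \<open>c (k + 1)\<close>. Differentiating gives \<open>r' = z\<^sup>2\<close>,
  so the offset is \<open>(r |z|\<^sup>2 - i h z\<^sup>2) / |z|\<^sup>2\<close>; the weights are the degree elevation of \<open>|z|\<^sup>2\<close> from 2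
  to 5, and the control points come from the Bezier product of \<open>r\<close> with \<open>|z|\<^sup>2\<close> and the elevation of
  \<open>z\<^sup>2\<close>.
\<close>

section \<open>Local support and the Bernstein form of B-splines\<close>

text \<open>Induction on the degree: both lower-degree splines of the recursion miss the cell as
  well, so the quotients in front of them never matter.\<close>

lemma bspline_eq_0:
  assumes "sorted \<kappa>" "J + 1 < length \<kappa>" "\<kappa> ! J \<le> u" "u < \<kappa> ! (J + 1)"
    and "i + n + 1 < length \<kappa>" "J < i \<or> i + n < J"
  shows "bspline \<kappa> n i u = 0"
  using assms(5,6)
proof (induction n arbitrary: i)
  case 0
  from 0(2) show ?case
  proof
    assume "J < i"
    then have "\<kappa> ! (J + 1) \<le> \<kappa> ! i"
      using assms(1) 0(1) by (intro sorted_nth_mono) auto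
    then show ?thesis using assms(4) by simp
  next
    assume "i + 0 < J"
    then have "\<kappa> ! (i + 1) \<le> \<kappa> ! J"
      using assms(1,2) by (intro sorted_nth_mono) auto
    then show ?thesis using assms(3) by simp
  qed
next
  case (Suc n)
  then have "bspline \<kappa> n i u = 0" "bspline \<kappa> n (i + 1) u = 0"
    by (auto intro!: Suc.IH)
  then show ?case by simp
qed

lemma Bernstein_Suc_0: "Bernstein (Suc n) 0 x = (1 - x) * Bernstein n 0 x"
  by (simp add: Bernstein_def)

lemma Bernstein_Suc_Suc:
  assumes "l \<le> n"
  shows "Bernstein (Suc n) (Suc l) x = x * Bernstein n l x + (1 - x) * Bernstein n (Suc l) x"
proof (cases "l = n")
  case True
  then show ?thesis by (simp add: Bernstein_def)
next
  case False
  with assms obtain e where "n = Suc l + e" by (metis le_neq_implies_less less_iff_Suc_add add_Suc)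
  then show ?thesis
    by (simp add: Bernstein_def algebra_simps)
qed

lemma Bernstein_gt: "n < l \<Longrightarrow> Bernstein n l x = 0"
  by (simp add: Bernstein_def)

text \<open>Between two blocks of \<open>N\<close> equal knots, every denominator in front of a
  spline that is alive on the cell equals \<open>b - a\<close>, so the recursion becomes that of the
  Bernstein polynomials. The number \<open>l\<close> counts the splines alive on the cell from the
  left. The knots \<open>J\<close> and \<open>J + 1\<close> are fixed separately because both ranges
  are empty for \<open>N = 0\<close>.\<close>

lemma bspline_Bernstein:
  assumes \<kappa>: "sorted \<kappa>" "J + 1 < length \<kappa>" and u: "a \<le> u" "u < b"
    and a: "\<kappa> ! J = a" "\<And>k. k \<le> J \<Longrightarrow> J < k + N \<Longrightarrow> \<kappa> ! k = a"
    and b: "\<kappa> ! (J + 1) = b" "\<And>k. J < k \<Longrightarrow> k \<le> J + N \<Longrightarrow> \<kappa> ! k = b"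
    and n: "n \<le> N" "i + n = J + l" "l \<le> n" "i + n + 1 < length \<kappa>"
  shows "bspline \<kappa> n i u = Bernstein n l ((u - a) / (b - a))"
  using n
proof (induction n arbitrary: i l)
  case 0
  then show ?case using u a(1) b(1) by (simp add: Bernstein_def)
next
  case (Suc n)
  define w where "w = (u - a) / (b - a)"
  have ab: "a < b" using u by simp
  have w1: "1 - w = (b - u) / (b - a)" using ab by (simp add: w_def field_simps)
  note zero = bspline_eq_0[OF \<kappa>, of u, unfolded a(1) b(1), OF u]
  \<comment> \<open>For \<open>l = 0\<close> the left summand ends before the cell; for
    \<open>l = Suc n\<close> the right one starts after it.\<close>
  show ?case
  proof (cases l)
    case 0
    have "bspline \<kappa> n i u = 0" using Suc.prems 0 by (intro zero) auto
    moreover have "bspline \<kappa> n (i + 1) u = Bernstein n 0 w"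
      unfolding w_def using Suc.prems 0 by (intro Suc.IH) auto
    moreover have "\<kappa> ! (i + Suc n + 1) = b" "\<kappa> ! (i + 1) = a"
      using Suc.prems 0 by (auto intro!: a b)
    ultimately show ?thesis
      using 0 by (simp add: Bernstein_Suc_0 w1 flip: w_def)
  next
    case (Suc l')
    have "bspline \<kappa> n i u = Bernstein n l' w"
      unfolding w_def using Suc.prems Suc by (intro Suc.IH) auto
    moreover have "\<kappa> ! (i + Suc n) = b" "\<kappa> ! i = a"
      using Suc.prems Suc by (auto intro!: a b)
    moreover have "(\<kappa> ! (i + Suc n + 1) - u) / (\<kappa> ! (i + Suc n + 1) - \<kappa> ! (i + 1)) * bspline \<kappa> n (i + 1) u
      = (1 - w) * Bernstein n l w"
    proof (cases "l = Suc n")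
      case True
      have "bspline \<kappa> n (i + 1) u = 0" using Suc.prems True by (intro zero) auto
      then show ?thesis using True by (simp add: Bernstein_gt)
    next
      case False
      have "bspline \<kappa> n (i + 1) u = Bernstein n l w"
        unfolding w_def using Suc.prems False by (intro Suc.IH) auto
      moreover have "\<kappa> ! (i + Suc n + 1) = b" "\<kappa> ! (i + 1) = a"
        using Suc.prems Suc False by (auto intro!: a b)
      ultimately show ?thesis by (simp add: w1)
    qed
    ultimately show ?thesis
      using Suc.prems Suc Bernstein_Suc_Suc[of l' n w] by (simp add: flip: w_def)
  qed
qed

text \<open>The guard serves cells near the end of the knot list, where an index between
  \<open>J - n\<close> and \<open>J\<close> may exceed \<open>N\<close>, so that the curve has no
  such coefficient.\<close>

lemma bspline_curve_local:
  assumes \<kappa>: "sorted \<kappa>" "J + 1 < length \<kappa>" "\<kappa> ! J \<le> u" "u < \<kappa> ! (J + 1)"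
    and "n \<le> J" "N + n + 1 < length \<kappa>"
  shows "bspline_curve \<kappa> n N c u =
    (\<Sum>l\<le>n. if J - n + l \<le> N then bspline \<kappa> n (J - n + l) u *\<^sub>R c (J - n + l) else 0)"
proof -
  let ?f = "\<lambda>i. if i \<le> N then bspline \<kappa> n i u *\<^sub>R c i else 0"
  have z: "bspline \<kappa> n i u = 0" if "i \<le> N" "i \<notin> {J - n..J}" for i
    using that assms by (intro bspline_eq_0[OF \<kappa>]) auto
  have "bspline_curve \<kappa> n N c u = sum ?f {0..N}"
    unfolding bspline_curve_def by (intro sum.cong) auto
  also have "\<dots> = sum ?f {J - n..J}"
    using z by (intro sum.mono_neutral_cong) auto
  also have "\<dots> = (\<Sum>l\<le>n. ?f (J - n + l))"
    using \<open>n \<le> J\<close> by (intro sum.reindex_bij_witness[of _ "\<lambda>l. J - n + l" "\<lambda>i. i - (J - n)"]) auto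
  finally show ?thesis .
qed

section \<open>Index formulas for the knot sequences\<close>

lemma concat_replicate_upt:
  "concat (map (\<lambda>k. replicate l (f k)) [0..<n]) = map (\<lambda>i. f (i div l)) [0..<l * n]"
proof (cases "l = 0")
  case False
  show ?thesis
  proof (induction n)
    case (Suc n)
    have "map (\<lambda>i. f (i div l)) [l * n..<l * Suc n] = replicate l (f n)"
      using False by (auto intro!: nth_equalityI simp: div_nat_eqI)
    moreover have "[0..<l * Suc n] = [0..<l * n] @ [l * n..<l * Suc n]"
      using upt_add_eq_append[of 0 "l * n" l] by (simp add: add.commute)
    moreover have "[0..<Suc n] = [0..<n] @ [n]"
      by simp
    ultimately show ?case
      using Suc by (simp del: upt_Suc mult_Suc_right)
  qed simp
qed (induction n, auto)

lemma length_mu: "length (mu_knots m t) = m + 4"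
  and length_rho: "length (rho_knots m t) = 2 * m + 10"
  and length_tau: "length (tau_knots m t) = 5 * m + 26"
  by (simp_all add: mu_knots_def rho_knots_def tau_knots_def rep_knots_def concat_replicate_upt)

lemma mu_nth: "i < m + 4 \<Longrightarrow> mu_knots m t ! i = t (int i)"
  by (simp add: mu_knots_def rep_knots_def concat_replicate_upt del: upt_Suc)

text \<open>Each single outer knot counts as half of a block of two, so one quotient covers the
  whole list.\<close>

lemma rho_nth:
  assumes "i < 2 * m + 10"
  shows "rho_knots m t ! i = t ((int i + 1) div 2 - 1)"
proof -
  consider "i = 0" | "0 < i" "i < 2 * m + 9" | "i = 2 * m + 9" using assms by linarith
  then show ?thesis
  proof cases
    case 2
    then have "(int i + 1) div 2 - 1 = int ((i - 1) div 2)" "i - 1 < 2 * m + 8" by linarith+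
    then show ?thesis
      using 2 by (simp add: rho_knots_def rep_knots_def concat_replicate_upt nth_append nth_Cons' del: upt_Suc)
  qed (simp_all add: rho_knots_def rep_knots_def concat_replicate_upt nth_append nth_Cons' add.commute)
qed

text \<open>The outer triples are truncated blocks of five; the shift by 2 stands for the two copies
  missing on the left.\<close>

lemma tau_nth:
  assumes "i < 5 * m + 26"
  shows "tau_knots m t ! i = t ((int i + 2) div 5 - 1)"
proof -
  consider "i < 3" | "3 \<le> i" "i < 5 * m + 23" | "5 * m + 23 \<le> i" using assms by linarith
  then show ?thesis
  proof cases
    case 1
    then have "(int i + 2) div 5 - 1 = -1" by linarith
    then show ?thesis using 1 by (simp add: tau_knots_def nth_append)
  next
    case 2
    then have "(int i + 2) div 5 - 1 = int ((i - 3) div 5)" "i - 3 < 5 * m + 20" by linarith+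
    then show ?thesis
      using 2 by (simp add: tau_knots_def rep_knots_def concat_replicate_upt nth_append del: upt_Suc replicate.simps)
  next
    case 3
    then have "(int i + 2) div 5 - 1 = int m + 4" using assms by linarith
    moreover have "\<not> i - 3 < 5 * m + 20" "i - 5 * m - 23 < 3" using 3 assms by linarith+
    ultimately show ?thesis
      using 3 by (simp add: add.commute tau_knots_def rep_knots_def concat_replicate_upt nth_append del: upt_Suc replicate.simps)
  qed
qed

lemma sorted_knots:
  assumes "strict_mono_on {-1..int m + 4} t"
  shows "sorted (mu_knots m t)" "sorted (rho_knots m t)" "sorted (tau_knots m t)"
  unfolding sorted_iff_nth_mono length_mu length_rho length_tau
  by (auto simp: mu_nth rho_nth tau_nth intro!: strict_mono_on_leD[OF assms])


section \<open>The spline curves over a single parameter cell\<close>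

text \<open>The last copy of \<open>t (k + 1)\<close> has index \<open>5 * k + 12\<close>. The case
  \<open>k = m + 1\<close>, one cell beyond the parameter interval, is included in order to evaluate
  at its right end \<open>t (m + 2)\<close>.\<close>

lemma tau_curve_half_open:
  assumes mono: "strict_mono_on {-1..int m + 4} t" and "k \<le> m + 1"
    and u: "t (int k + 1) \<le> u" "u < t (int k + 2)"
  shows "bspline_curve (tau_knots m t) 5 (5 * m + 19) c u =
    (\<Sum>l\<le>5. Bernstein 5 l ((u - t (int k + 1)) / (t (int k + 2) - t (int k + 1))) *\<^sub>R c (5 * k + 7 + l))"
proof -
  have J: "tau_knots m t ! i = t (int k + 1)" if "5 * k + 8 \<le> i" "i \<le> 5 * k + 12" for i
  proof -
    have "(int i + 2) div 5 - 1 = int k + 1" "i < 5 * m + 26" using that assms(2) by linarith+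
    then show ?thesis by (simp only: tau_nth)
  qed
  have J': "tau_knots m t ! i = t (int k + 2)" if "5 * k + 13 \<le> i" "i \<le> 5 * k + 17" for i
  proof -
    have "(int i + 2) div 5 - 1 = int k + 2" "i < 5 * m + 26" using that assms(2) by linarith+
    then show ?thesis by (simp only: tau_nth)
  qed
  have "bspline (tau_knots m t) 5 (5 * k + 7 + l) u =
      Bernstein 5 l ((u - t (int k + 1)) / (t (int k + 2) - t (int k + 1)))" if "l \<le> 5" for l
    using that assms
    by (intro bspline_Bernstein[where N = 5 and J = "5 * k + 12"] sorted_knots[OF mono] u)
       (auto simp: J J' length_tau)
  then show ?thesis
    using assms
    by (subst bspline_curve_local[where J = "5 * k + 12"])
       (auto simp: J J' length_tau sorted_knots add.commute[of "5 * k"] intro!: sum.cong)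
qed

lemma Bernstein_at_0: "Bernstein n l 0 = (if l = 0 then 1 else 0)"
  and Bernstein_at_1: "l \<le> n \<Longrightarrow> Bernstein n l 1 = (if l = n then 1 else 0)"
  by (auto simp: Bernstein_def)

text \<open>Splines of degree 0 are half-open, so the right end is evaluated on the next cell. The
  first control point there, of index \<open>5 * (k + 1) + 7\<close>, is the last one of this
  cell.\<close>

lemma tau_curve:
  assumes mono: "strict_mono_on {-1..int m + 4} t" and "k \<le> m"
    and u: "u \<in> {t (int k + 1)..t (int k + 2)}"
  shows "bspline_curve (tau_knots m t) 5 (5 * m + 19) c u =
    (\<Sum>l\<le>5. Bernstein 5 l ((u - t (int k + 1)) / (t (int k + 2) - t (int k + 1))) *\<^sub>R c (5 * k + 7 + l))"
proof (cases "u < t (int k + 2)")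
  case False
  then have u': "u = t (int k + 2)" using u by simp
  have "t (int k + 1) < t (int k + 2)" "t (int k + 2) < t (int k + 3)"
    using mono \<open>k \<le> m\<close> by (auto simp: strict_mono_on_def)
  then show ?thesis
    using tau_curve_half_open[OF mono, of "k + 1" u c] assms
    by (simp add: u' add.commute Bernstein_at_0 Bernstein_at_1 if_distrib[of "\<lambda>x. x *\<^sub>R _"] sum.delta cong: if_cong)
qed (use tau_curve_half_open[OF mono, of k u c] assms in auto)

lemma mu_curve:
  assumes mono: "strict_mono_on {-1..int m + 4} t" and "k \<le> m"
    and u: "u \<in> {t (int k + 1)..t (int k + 2)}"
    and w: "w = (u - t (int k + 1)) / (t (int k + 2) - t (int k + 1))"
  shows "bspline_curve (mu_knots m t) 1 (m + 1) z u = (1 - w) *\<^sub>R z k + w *\<^sub>R z (k + 1)"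
proof -
  \<comment> \<open>The case \<open>k = m + 1\<close>, where the last coefficient is missing from the curve, is only used
    at the left end \<open>u = t (m + 2)\<close>, to close the preceding cell.\<close>
  have half_open: "bspline_curve (mu_knots m t) 1 (m + 1) z u =
      (1 - w) *\<^sub>R z k + (if k \<le> m then w *\<^sub>R z (k + 1) else 0)"
    if "k \<le> m + 1" and u: "t (int k + 1) \<le> u" "u < t (int k + 2)"
      and w: "w = (u - t (int k + 1)) / (t (int k + 2) - t (int k + 1))" for k w
  proof -
    have J: "mu_knots m t ! (k + 1) = t (int k + 1)" "mu_knots m t ! Suc k = t (int k + 1)"
      "mu_knots m t ! (k + 2) = t (int k + 2)" "mu_knots m t ! Suc (Suc k) = t (int k + 2)"
      using that by (simp_all add: mu_nth add.commute)
    have "bspline (mu_knots m t) 1 (k + l) u = Bernstein 1 l w" if "l \<le> 1" "k + l \<le> m + 1" for l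
      unfolding w using that \<open>k \<le> m + 1\<close>
      by (intro bspline_Bernstein[where N = 1 and J = "k + 1"] sorted_knots[OF mono] u)
         (auto simp: J length_mu le_Suc_eq)
    from this[of 0] this[of 1] show ?thesis
      using that
      by (subst bspline_curve_local[where J = "k + 1"])
         (auto simp: J length_mu sorted_knots[OF mono] Bernstein_def)
  qed
  show ?thesis
  proof (cases "u < t (int k + 2)")
    case False
    then have u': "u = t (int k + 2)" using u by simp
    have "t (int k + 1) < t (int k + 2)" "t (int k + 2) < t (int k + 3)"
      using mono \<open>k \<le> m\<close> by (auto simp: strict_mono_on_def)
    then show ?thesis
      using half_open[of "k + 1" 0] assms by (simp add: u' add.commute)
  qed (use half_open[of k w] assms in auto)
qed

text \<open>Double knots give Bernstein polynomials only up to degree 2; the third step of the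
  recursion also involves \<open>t k\<close> and \<open>t (k + 3)\<close>. It splits the factor
  \<open>(1 - w) ^ 3\<close> between \<open>r (2 * k + 1)\<close> and \<open>r (2 * k + 2)\<close>,
  which yields \<open>c k\<close>, the curve point at \<open>t (k + 1)\<close>;
  \<open>c (k + 1)\<close> arises symmetrically.\<close>

lemma rho_curve:
  fixes t :: "int \<Rightarrow> real" and r :: "nat \<Rightarrow> 'a::real_vector"
  assumes mono: "strict_mono_on {-1..int m + 4} t" and "k \<le> m"
    and u: "u \<in> {t (int k + 1)..t (int k + 2)}"
    and w: "w = (u - t (int k + 1)) / (t (int k + 2) - t (int k + 1))"
  defines "c \<equiv> \<lambda>k. ((t (int k + 2) - t (int k + 1)) / (t (int k + 2) - t (int k))) *\<^sub>R r (2 * k + 1)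
    + ((t (int k + 1) - t (int k)) / (t (int k + 2) - t (int k))) *\<^sub>R r (2 * k + 2)"
  shows "bspline_curve (rho_knots m t) 3 (2 * m + 5) r u =
    (1 - w) ^ 3 *\<^sub>R c k + (3 * w * (1 - w) ^ 2) *\<^sub>R r (2 * k + 2)
      + (3 * w ^ 2 * (1 - w)) *\<^sub>R r (2 * k + 3) + w ^ 3 *\<^sub>R c (k + 1)"
proof -
  \<comment> \<open>For \<open>k = m + 1\<close>, which serves only the point
    \<open>t (m + 2)\<close>, the index \<open>2 * k + 4\<close> exceeds \<open>2 * m + 5\<close>
    and its spline would inspect a knot past the end of the list. Hence the condition on the fourth
    term.\<close>
  have coeffs: "bspline (rho_knots m t) 3 (2 * k + 1) u
        = (1 - w) ^ 3 * ((t (int k + 2) - t (int k + 1)) / (t (int k + 2) - t (int k)))"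
      "bspline (rho_knots m t) 3 (2 * k + 2) u
        = (1 - w) ^ 3 * ((t (int k + 1) - t (int k)) / (t (int k + 2) - t (int k))) + 3 * w * (1 - w) ^ 2"
      "bspline (rho_knots m t) 3 (2 * k + 3) u
        = 3 * w ^ 2 * (1 - w) + w ^ 3 * ((t (int k + 3) - t (int k + 2)) / (t (int k + 3) - t (int k + 1)))"
      "k \<le> m \<Longrightarrow> bspline (rho_knots m t) 3 (2 * k + 4) u
        = w ^ 3 * ((t (int k + 2) - t (int k + 1)) / (t (int k + 3) - t (int k + 1)))" (is "_ \<Longrightarrow> ?th4")
      "bspline_curve (rho_knots m t) 3 (2 * m + 5) r u =
        bspline (rho_knots m t) 3 (2 * k + 1) u *\<^sub>R r (2 * k + 1)
        + bspline (rho_knots m t) 3 (2 * k + 2) u *\<^sub>R r (2 * k + 2)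
        + bspline (rho_knots m t) 3 (2 * k + 3) u *\<^sub>R r (2 * k + 3)
        + (if k \<le> m then bspline (rho_knots m t) 3 (2 * k + 4) u *\<^sub>R r (2 * k + 4) else 0)" (is ?th5)
    if "k \<le> m + 1" and u: "t (int k + 1) \<le> u" "u < t (int k + 2)"
      and w: "w = (u - t (int k + 1)) / (t (int k + 2) - t (int k + 1))" for k w
  proof -
    \<comment> \<open>The offset \<open>j\<close> is counted from \<open>t (k + 1)\<close>; the
      bounds on \<open>i\<close> enclose the two copies of the knot.\<close>
    have *: "rho_knots m t ! i = t (int k + 1 + j)"
      if "2 * (int k + 1 + j) + 1 \<le> int i" "int i \<le> 2 * (int k + 1 + j) + 2" "i < 2 * m + 10" for i j
    proof -
      have "(int i + 1) div 2 - 1 = int k + 1 + j" using that by presburger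
      then show ?thesis using that by (simp only: rho_nth)
    qed
    \<comment> \<open>The knots of index \<open>2 * k + 1\<close> and \<open>2 * k + 8\<close> are
      absent: they occur only in factors of the quadratic splines that vanish by
      \<open>B0\<close>.\<close>
    have K: "rho_knots m t ! (2 * k + 2) = t (int k)"
      "rho_knots m t ! (2 * k + 3) = t (int k + 1)" "rho_knots m t ! (2 * k + 4) = t (int k + 1)"
      "rho_knots m t ! (2 * k + 5) = t (int k + 2)" "rho_knots m t ! (2 * k + 6) = t (int k + 2)"
      "rho_knots m t ! (2 * k + 7) = t (int k + 3)"
      using *[of "-1" "2 * k + 2"] *[of 0 "2 * k + 3"] *[of 0 "2 * k + 4"] *[of 1 "2 * k + 5"]
        *[of 1 "2 * k + 6"] *[of 2 "2 * k + 7"] \<open>k \<le> m + 1\<close>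
      by (simp_all add: algebra_simps)
    note sorted = sorted_knots(2)[OF mono]
    have B2: "bspline (rho_knots m t) 2 (2 * k + 2 + l) u = Bernstein 2 l w" if "l \<le> 2" for l
      unfolding w
    proof (rule bspline_Bernstein[where N = 2 and J = "2 * k + 4"])
      fix i
      show "rho_knots m t ! i = t (int k + 1)" if "i \<le> 2 * k + 4" "2 * k + 4 < i + 2"
      proof -
        have "i = 2 * k + 3 \<or> i = 2 * k + 4" using that by auto
        then show ?thesis using K by auto
      qed
      show "rho_knots m t ! i = t (int k + 2)" if "2 * k + 4 < i" "i \<le> 2 * k + 4 + 2"
      proof -
        have "i = 2 * k + 5 \<or> i = 2 * k + 6" using that by auto
        then show ?thesis using K by auto
      qed
    qed (use u K sorted \<open>l \<le> 2\<close> \<open>k \<le> m + 1\<close> in \<open>auto simp: length_rho add.commute[of "2 * k"]\<close>)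
    have B: "bspline (rho_knots m t) 2 (2 * k + 2) u = (1 - w) ^ 2"
       "bspline (rho_knots m t) 2 (2 * k + 3) u = 2 * w * (1 - w)"
       "bspline (rho_knots m t) 2 (2 * k + 4) u = w ^ 2"
      using B2[of 0] B2[of 1] B2[of 2] by (simp_all add: Bernstein_def numeral_eq_Suc)
    have B0: "bspline (rho_knots m t) 2 (2 * k + 1) u = 0"
      "k \<le> m \<Longrightarrow> bspline (rho_knots m t) 2 (2 * k + 5) u = 0"
       using K u \<open>k \<le> m + 1\<close> 
       by (auto simp: length_rho add.commute[of "2 * k"] intro!: bspline_eq_0[OF sorted, where J = "2 * k + 4"])
    \<comment> \<open>A free \<open>\<kappa>\<close> settles the index arithmetic before
      \<open>K\<close> inserts the knots.\<close>
    have rec: "bspline \<kappa> 3 (2 * k + 1) u =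
      (u - \<kappa> ! (2 * k + 1)) / (\<kappa> ! (2 * k + 4) - \<kappa> ! (2 * k + 1)) * bspline \<kappa> 2 (2 * k + 1) u
      + (\<kappa> ! (2 * k + 5) - u) / (\<kappa> ! (2 * k + 5) - \<kappa> ! (2 * k + 2)) * bspline \<kappa> 2 (2 * k + 2) u"
      "bspline \<kappa> 3 (2 * k + 2) u =
      (u - \<kappa> ! (2 * k + 2)) / (\<kappa> ! (2 * k + 5) - \<kappa> ! (2 * k + 2)) * bspline \<kappa> 2 (2 * k + 2) u
      + (\<kappa> ! (2 * k + 6) - u) / (\<kappa> ! (2 * k + 6) - \<kappa> ! (2 * k + 3)) * bspline \<kappa> 2 (2 * k + 3) u"
      "bspline \<kappa> 3 (2 * k + 3) u =
      (u - \<kappa> ! (2 * k + 3)) / (\<kappa> ! (2 * k + 6) - \<kappa> ! (2 * k + 3)) * bspline \<kappa> 2 (2 * k + 3) u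
      + (\<kappa> ! (2 * k + 7) - u) / (\<kappa> ! (2 * k + 7) - \<kappa> ! (2 * k + 4)) * bspline \<kappa> 2 (2 * k + 4) u"
      "bspline \<kappa> 3 (2 * k + 4) u =
      (u - \<kappa> ! (2 * k + 4)) / (\<kappa> ! (2 * k + 7) - \<kappa> ! (2 * k + 4)) * bspline \<kappa> 2 (2 * k + 4) u
      + (\<kappa> ! (2 * k + 8) - u) / (\<kappa> ! (2 * k + 8) - \<kappa> ! (2 * k + 5)) * bspline \<kappa> 2 (2 * k + 5) u"
      for \<kappa>
      by (simp_all add: numeral_eq_Suc)
    have "t (int k) < t (int k + 1)" "t (int k + 1) < t (int k + 2)" "t (int k + 2) < t (int k + 3)"
      using mono \<open>k \<le> m + 1\<close> by (auto simp: strict_mono_on_def)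
    \<comment> \<open>With four variables for the knots and \<open>u\<close> eliminated by
      \<open>uw\<close>, each coefficient is a rational identity with denominators nonzero by
      \<open>lt\<close>.\<close>
    moreover define x where "x = t (int k)"
    moreover define a where "a = t (int k + 1)"
    moreover define b where "b = t (int k + 2)"
    moreover define y where "y = t (int k + 3)"
    ultimately have lt: "x < a" "a < b" "b < y" by simp_all
    have uw: "u = a + w * (b - a)" using lt by (simp add: w flip: a_def b_def)
    show "bspline (rho_knots m t) 3 (2 * k + 1) u
        = (1 - w) ^ 3 * ((t (int k + 2) - t (int k + 1)) / (t (int k + 2) - t (int k)))"
      using lt unfolding rec K B B0 x_def[symmetric] a_def[symmetric] b_def[symmetric] y_def[symmetric]
      by (simp add: uw field_simps power2_eq_square power3_eq_cube)
    show "bspline (rho_knots m t) 3 (2 * k + 2) u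
        = (1 - w) ^ 3 * ((t (int k + 1) - t (int k)) / (t (int k + 2) - t (int k))) + 3 * w * (1 - w) ^ 2"
      using lt unfolding rec K B B0 x_def[symmetric] a_def[symmetric] b_def[symmetric] y_def[symmetric]
      by (simp add: uw divide_simps, simp add: algebra_simps power2_eq_square power3_eq_cube)
    show "bspline (rho_knots m t) 3 (2 * k + 3) u
        = 3 * w ^ 2 * (1 - w) + w ^ 3 * ((t (int k + 3) - t (int k + 2)) / (t (int k + 3) - t (int k + 1)))"
      using lt unfolding rec K B B0 x_def[symmetric] a_def[symmetric] b_def[symmetric] y_def[symmetric]
      by (simp add: uw divide_simps, simp add: algebra_simps power2_eq_square power3_eq_cube)
    show ?th4 if "k \<le> m"
      using lt unfolding rec K B B0(2)[OF that] x_def[symmetric] a_def[symmetric] b_def[symmetric] y_def[symmetric]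
      by (simp add: uw field_simps power2_eq_square power3_eq_cube)
    have curve: "bspline_curve (rho_knots m t) 3 (2 * m + 5) r u =
      (\<Sum>l\<le>3. if 2 * k + 1 + l \<le> 2 * m + 5
        then bspline (rho_knots m t) 3 (2 * k + 1 + l) u *\<^sub>R r (2 * k + 1 + l) else 0)"
      using that K
      by (subst bspline_curve_local[where J = "2 * k + 4"])
         (auto simp: length_rho sorted add.commute[of "2 * k"] intro!: sum.cong)
    have "{..3::nat} = {0, 1, 2, 3}" by auto
    then show ?th5
      using \<open>k \<le> m + 1\<close> unfolding curve
      by (simp add: add.commute[of "2 * k"] add.assoc) (simp add: eval_nat_numeral del: bspline.simps)
  qed
  have lt: "t (int k + 1) < t (int k + 2)" "t (int k + 2) < t (int k + 3)"
    using mono \<open>k \<le> m\<close> by (auto simp: strict_mono_on_def)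
  have k1: "t (int (k + 1) + 1) = t (int k + 2)" "t (int (k + 1) + 2) = t (int k + 3)"
    "t (int (k + 1)) = t (int k + 1)"
    by (simp_all add: algebra_simps)
  have idx: "2 * (k + 1) + 1 = 2 * k + 3" "2 * (k + 1) + 2 = 2 * k + 4" by simp_all
  have c_Suc: "c (k + 1) = ((t (int k + 3) - t (int k + 2)) / (t (int k + 3) - t (int k + 1))) *\<^sub>R r (2 * k + 3)
    + ((t (int k + 2) - t (int k + 1)) / (t (int k + 3) - t (int k + 1))) *\<^sub>R r (2 * k + 4)"
    unfolding c_def k1 idx by (rule refl)
  show ?thesis
  proof (cases "u < t (int k + 2)")
    case True
    have "k \<le> m + 1" "t (int k + 1) \<le> u" using u \<open>k \<le> m\<close> by auto
    note coeffs' = coeffs[OF this True w]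
    show ?thesis
      unfolding coeffs'(5) coeffs'(1-3) coeffs'(4)[OF \<open>k \<le> m\<close>] c_Suc
      using \<open>k \<le> m\<close> by (simp add: c_def scaleR_add_left scaleR_add_right)
  next
    case False
    \<comment> \<open>The next cell applies with parameter 0, where the first two coefficients are
      the weights of \<open>c (k + 1)\<close>.\<close>
    then have u': "u = t (int k + 2)" using u by simp
    then have "w = 1" using lt by (simp add: w)
    have "k + 1 \<le> m + 1" "t (int (k + 1) + 1) \<le> u" "u < t (int (k + 1) + 2)"
      "0 = (u - t (int (k + 1) + 1)) / (t (int (k + 1) + 2) - t (int (k + 1) + 1))"
      using \<open>k \<le> m\<close> lt unfolding k1 u' by auto
    note coeffs' = coeffs[OF this, unfolded k1 idx]
    show ?thesis
      unfolding coeffs'(5) coeffs'(1-3) c_Suc \<open>w = 1\<close>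
      using coeffs'(4) by simp
  qed
qed

section \<open>Differentiation on cells and across knots\<close>

lemma has_vector_derivative_within_Un:
  assumes "(f has_vector_derivative f') (at x within S)" "(f has_vector_derivative f') (at x within T)"
  shows "(f has_vector_derivative f') (at x within S \<union> T)"
  using assms unfolding has_vector_derivative_def has_derivative_within
  by (auto simp: at_within_union intro: filterlim_sup)

text \<open>The filter is trivial away from \<open>S\<close>, so every value is a derivative. Cells
  can thus be glued without asking on which side of a knot the point lies.\<close>

lemma has_vector_derivative_within_notin_closed:
  assumes "closed S" "x \<notin> S"
  shows "(f has_vector_derivative f') (at x within S)"
proof -
  have "at x within S = bot"
    using assms by (simp add: at_within_eq_bot_iff)
  then show ?thesis
    unfolding has_vector_derivative_def has_derivative_within by (simp add: bounded_linear_scaleR_left)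
qed

text \<open>Cubic Bernstein polynomials have multiples of differences of quadratic ones as
  derivatives (\<open>d0\<close> to \<open>d3\<close>); regrouping moves the differences to the
  control points.\<close>

lemma cubic_Bezier_has_vector_derivative:
  fixes c0 c1 c2 c3 :: "'a::real_normed_vector" and a b :: real
  defines "w \<equiv> \<lambda>x. (x - a) / (b - a)"
  assumes "a < b"
  shows "((\<lambda>x. (1 - w x) ^ 3 *\<^sub>R c0 + (3 * w x * (1 - w x) ^ 2) *\<^sub>R c1
      + (3 * w x ^ 2 * (1 - w x)) *\<^sub>R c2 + w x ^ 3 *\<^sub>R c3)
    has_vector_derivative (3 / (b - a)) *\<^sub>R ((1 - w x) ^ 2 *\<^sub>R (c1 - c0)
      + (2 * w x * (1 - w x)) *\<^sub>R (c2 - c1) + w x ^ 2 *\<^sub>R (c3 - c2))) (at x within S)"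
proof -
  have w: "(w has_field_derivative 1 / (b - a)) (at x within S)"
    unfolding w_def using \<open>a < b\<close> by (auto intro!: derivative_eq_intros)
  define e where "e = 1 / (b - a)"
  have e: "3 / (b - a) = 3 * e" by (simp add: e_def)
  note w = w[folded e_def]
  have d0: "((\<lambda>x. (1 - w x) ^ 3) has_field_derivative - (3 * e * (1 - w x) ^ 2)) (at x within S)"
    and d1: "((\<lambda>x. 3 * w x * (1 - w x) ^ 2) has_field_derivative
      3 * e * ((1 - w x) ^ 2 - 2 * w x * (1 - w x))) (at x within S)"
    and d2: "((\<lambda>x. 3 * w x ^ 2 * (1 - w x)) has_field_derivative
      3 * e * (2 * w x * (1 - w x) - w x ^ 2)) (at x within S)"
    and d3: "((\<lambda>x. w x ^ 3) has_field_derivative 3 * e * w x ^ 2) (at x within S)"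
    by (auto intro!: derivative_eq_intros w simp: algebra_simps power2_eq_square)
  show ?thesis
    unfolding e
    by (rule derivative_eq_intros d0 d1 d2 d3 refl)+ (simp add: algebra_simps)
qed

section \<open>Degree elevation and products in Bezier form\<close>

text \<open>Elevation is multiplication by \<open>(v + w) ^ 3\<close>, which is 1 for
  \<open>v = 1 - w\<close>; the fractions are the new coefficients divided by
  \<open>5 choose j\<close>.\<close>

lemma Bezier_elevate:
  fixes w :: "'a::field_char_0"
  shows "(1 - w) ^ 5 * s1 + 5 * w * (1 - w) ^ 4 * (3/5 * s1 + 2/5 * s2)
    + 10 * w ^ 2 * (1 - w) ^ 3 * (3/10 * s1 + 3/5 * s2 + 1/10 * s3)
    + 10 * w ^ 3 * (1 - w) ^ 2 * (1/10 * s1 + 3/5 * s2 + 3/10 * s3)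
    + 5 * w ^ 4 * (1 - w) * (2/5 * s2 + 3/5 * s3) + w ^ 5 * s3
    = (1 - w) ^ 2 * s1 + 2 * w * (1 - w) * s2 + w ^ 2 * s3"
proof -
  have "v ^ 5 * s1 + 5 * w * v ^ 4 * (3/5 * s1 + 2/5 * s2)
    + 10 * w ^ 2 * v ^ 3 * (3/10 * s1 + 3/5 * s2 + 1/10 * s3)
    + 10 * w ^ 3 * v ^ 2 * (1/10 * s1 + 3/5 * s2 + 3/10 * s3)
    + 5 * w ^ 4 * v * (2/5 * s2 + 3/5 * s3) + w ^ 5 * s3
    = (v + w) ^ 3 * (v ^ 2 * s1 + 2 * w * v * s2 + w ^ 2 * s3)" for v
    by (simp add: algebra_simps eval_nat_numeral)
  from this[of "1 - w"] show ?thesis by simp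
qed

text \<open>Counting from 0, the \<open>i\<close>-th cubic and \<open>j\<close>-th quadratic control
  points meet with the factor
  \<open>(3 choose i) * (2 choose j) / (5 choose (i + j))\<close>.\<close>

lemma Bezier_product:
  fixes v w :: "'a::field_char_0"
  shows "v ^ 5 * (c0 * s1) + 5 * w * v ^ 4 * (3/5 * c1 * s1 + 2/5 * c0 * s2)
    + 10 * w ^ 2 * v ^ 3 * (3/10 * c2 * s1 + 3/5 * c1 * s2 + 1/10 * c0 * s3)
    + 10 * w ^ 3 * v ^ 2 * (1/10 * c3 * s1 + 3/5 * c2 * s2 + 3/10 * c1 * s3)
    + 5 * w ^ 4 * v * (2/5 * c3 * s2 + 3/5 * c2 * s3) + w ^ 5 * (c3 * s3)
    = (v ^ 3 * c0 + 3 * w * v ^ 2 * c1 + 3 * w ^ 2 * v * c2 + w ^ 3 * c3)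
      * (v ^ 2 * s1 + 2 * w * v * s2 + w ^ 2 * s3)"
  by (simp add: algebra_simps eval_nat_numeral)

lemma sum_Bernstein_5:
  "(\<Sum>l\<le>5. Bernstein 5 l w *\<^sub>R f l) = (1 - w) ^ 5 *\<^sub>R f 0 + (5 * w * (1 - w) ^ 4) *\<^sub>R f 1
    + (10 * w ^ 2 * (1 - w) ^ 3) *\<^sub>R f 2 + (10 * w ^ 3 * (1 - w) ^ 2) *\<^sub>R f 3
    + (5 * w ^ 4 * (1 - w)) *\<^sub>R f 4 + w ^ 5 *\<^sub>R f 5"
proof -
  have "{..5::nat} = {0, 1, 2, 3, 4, 5}" by auto
  then show ?thesis by (simp add: Bernstein_def binomial_fact fact_numeral add.assoc)
qed

section \<open>The offset curve as a rational quintic spline\<close>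

theorem mainTheorem12:
  fixes m :: nat
    and t :: "int \<Rightarrow> real"
    and d :: "nat \<Rightarrow> real"
    and z p r c q :: "nat \<Rightarrow> complex"
    and \<sigma> \<gamma> :: "nat \<Rightarrow> real"
    and h :: real
  assumes m: "m \<ge> 1"
    and t0: "t 0 = 0"
    and t_mono: "strict_mono_on {-1..int m + 4} t"
    and d: "\<And>k. k \<le> m + 4 \<Longrightarrow> d k = t (int k) - t (int k - 1)"
    and d_periodic: "d (m + 2) = d 1" "d (m + 3) = d 2"
    and p_ends: "p 0 = 0" "p (2*m + 4) = 0"
    and \<sigma>_ends: "\<sigma> 0 = 0" "\<sigma> (2*m + 4) = 0"
    and p_odd: "\<And>k. k \<le> m + 1 \<Longrightarrow> p (2*k + 1) = (z k)^2"
    and \<sigma>_odd: "\<And>k. k \<le> m + 1 \<Longrightarrow> of_real (\<sigma> (2*k + 1)) = z k * cnj (z k)"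
    and p_even: "\<And>k. k \<le> m \<Longrightarrow> p (2*k + 2) = z k * z (k + 1)"
    and \<sigma>_even: "\<And>k. k \<le> m \<Longrightarrow>
      of_real (\<sigma> (2*k + 2)) = 1/2 * (z k * cnj (z (k + 1)) + z (k + 1) * cnj (z k))"
    and closing: "\<And>k. k \<in> {0, 1} \<Longrightarrow>
      (\<Sum>j = 2 - k..2*m + 3 - k.
         of_real (nu_knots m t ! (j + 3) - nu_knots m t ! j) * p j) = 0"
    and r_start: "r 1 = r 0"
    and r_even: "\<And>i. i \<le> m + 1 \<Longrightarrow>
      r (2*i + 2) = r (2*i + 1) + of_real ((d (i + 1) + d (i + 2)) / 3) * (z i)^2"
    and r_odd: "\<And>i. i \<le> m \<Longrightarrow>
      r (2*i + 3) = r (2*i + 2) + of_real (d (i + 2) / 3) * z i * z (i + 1)"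
    and r_end: "r (2*m + 5) = r (2*m + 4)"
    and z_nonzero: "\<And>u. u \<in> {t 1..t (int m + 2)} \<Longrightarrow>
      bspline_curve (mu_knots m t) 1 (m + 1) z u \<noteq> 0"
    and c: "\<And>k. k \<le> m + 1 \<Longrightarrow>
      c k = of_real (d (k + 2) / (d (k + 1) + d (k + 2))) * r (2*k + 1)
          + of_real (d (k + 1) / (d (k + 1) + d (k + 2))) * r (2*k + 2)"
    and \<gamma>_zero: "\<And>k. k \<in> {0..3} \<union> {5*m + 16..5*m + 19} \<Longrightarrow> \<gamma> k = 0"
    and q_zero: "\<And>k. k \<in> {0..3} \<union> {5*m + 16..5*m + 19} \<Longrightarrow> q k = 0"
    and \<gamma>_start:
      "\<gamma> 4 = d 0 / (10 * (d 0 + d 1)) * \<sigma> 1"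
      "\<gamma> 5 = 3/10 * \<sigma> 1"
      "\<gamma> 6 = 3/5 * \<sigma> 1"
    and \<gamma>_end:
      "\<gamma> (5*m + 13) = 3/5 * \<sigma> (2*m + 3)"
      "\<gamma> (5*m + 14) = 3/10 * \<sigma> (2*m + 3)"
      "\<gamma> (5*m + 15) = d (m + 4) / (10 * (d (m + 3) + d (m + 4))) * \<sigma> (2*m + 3)"
    and q_start:
      "q 4 = of_real (d 0 / (10 * (d 0 + d 1))) * (r 0 * of_real (\<sigma> 1) - \<i> * of_real h * p 1)"
      "q 5 = 3/10 * (r 0 * of_real (\<sigma> 1) - \<i> * of_real h * p 1)"
      "q 6 = 3/5 * (r 1 * of_real (\<sigma> 1) - \<i> * of_real h * p 1)"
    and q_end:
      "q (5*m + 13) =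
         3/5 * (r (2*m + 4) * of_real (\<sigma> (2*m + 3)) - \<i> * of_real h * p (2*m + 3))"
      "q (5*m + 14) =
         3/10 * (r (2*m + 5) * of_real (\<sigma> (2*m + 3)) - \<i> * of_real h * p (2*m + 3))"
      "q (5*m + 15) = of_real (d (m + 4) / (10 * (d (m + 3) + d (m + 4))))
         * (r (2*m + 5) * of_real (\<sigma> (2*m + 3)) - \<i> * of_real h * p (2*m + 3))"
    and \<gamma>_7: "\<And>k. k \<le> m + 1 \<Longrightarrow> \<gamma> (5*k + 7) = \<sigma> (2*k + 1)"
    and q_7: "\<And>k. k \<le> m + 1 \<Longrightarrow>
      q (5*k + 7) = c k * of_real (\<sigma> (2*k + 1)) - \<i> * of_real h * p (2*k + 1)"
    and \<gamma>_8: "\<And>k. k \<le> m \<Longrightarrow>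
      \<gamma> (5*k + 8) = 3/5 * \<sigma> (2*k + 1) + 2/5 * \<sigma> (2*k + 2)"
    and \<gamma>_9: "\<And>k. k \<le> m \<Longrightarrow>
      \<gamma> (5*k + 9) = 3/10 * \<sigma> (2*k + 1) + 3/5 * \<sigma> (2*k + 2) + 1/10 * \<sigma> (2*k + 3)"
    and \<gamma>_10: "\<And>k. k \<le> m \<Longrightarrow>
      \<gamma> (5*k + 10) = 1/10 * \<sigma> (2*k + 1) + 3/5 * \<sigma> (2*k + 2) + 3/10 * \<sigma> (2*k + 3)"
    and \<gamma>_11: "\<And>k. k \<le> m \<Longrightarrow>
      \<gamma> (5*k + 11) = 2/5 * \<sigma> (2*k + 2) + 3/5 * \<sigma> (2*k + 3)"
    and q_8: "\<And>k. k \<le> m \<Longrightarrow>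
      q (5*k + 8) = 3/5 * r (2*k + 2) * of_real (\<sigma> (2*k + 1))
        + 2/5 * c k * of_real (\<sigma> (2*k + 2))
        - \<i> * of_real h * (3/5 * p (2*k + 1) + 2/5 * p (2*k + 2))"
    and q_9: "\<And>k. k \<le> m \<Longrightarrow>
      q (5*k + 9) = 3/10 * r (2*k + 3) * of_real (\<sigma> (2*k + 1))
        + 3/5 * r (2*k + 2) * of_real (\<sigma> (2*k + 2))
        + 1/10 * c k * of_real (\<sigma> (2*k + 3))
        - \<i> * of_real h * (3/10 * p (2*k + 1) + 3/5 * p (2*k + 2) + 1/10 * p (2*k + 3))"
    and q_10: "\<And>k. k \<le> m \<Longrightarrow>
      q (5*k + 10) = 1/10 * c (k + 1) * of_real (\<sigma> (2*k + 1))
        + 3/5 * r (2*k + 3) * of_real (\<sigma> (2*k + 2))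
        + 3/10 * r (2*k + 2) * of_real (\<sigma> (2*k + 3))
        - \<i> * of_real h * (1/10 * p (2*k + 1) + 3/5 * p (2*k + 2) + 3/10 * p (2*k + 3))"
    and q_11: "\<And>k. k \<le> m \<Longrightarrow>
      q (5*k + 11) = 2/5 * c (k + 1) * of_real (\<sigma> (2*k + 2))
        + 3/5 * r (2*k + 3) * of_real (\<sigma> (2*k + 3))
        - \<i> * of_real h * (2/5 * p (2*k + 2) + 3/5 * p (2*k + 3))"
  shows "\<forall>u \<in> {t 1..t (int m + 2)}.
      bspline_curve (tau_knots m t) 5 (5*m + 19) \<gamma> u \<noteq> 0 \<and>
      offset_curve {t 1..t (int m + 2)} (bspline_curve (rho_knots m t) 3 (2*m + 5) r) h u
        = bspline_curve (tau_knots m t) 5 (5*m + 19) q u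
          / of_real (bspline_curve (tau_knots m t) 5 (5*m + 19) \<gamma> u)"
proof -
  define Z where "Z = bspline_curve (mu_knots m t) 1 (m + 1) z"
  define R where "R = bspline_curve (rho_knots m t) 3 (2 * m + 5) r"
  \<comment> \<open>Since the parameter interval starts at \<open>t 1\<close>, cell \<open>k\<close>
    begins at \<open>t (k + 1)\<close>; its length is \<open>d (k + 2)\<close>.\<close>
  define I where "I k = {t (int k + 1)..t (int k + 2)}" for k
  define w where "w k u = (u - t (int k + 1)) / (t (int k + 2) - t (int k + 1))" for k u
  have less: "t (int k + 1) < t (int k + 2)" if "k \<le> m" for k
    using t_mono that by (auto simp: strict_mono_on_def)
  have d_pos: "d k > 0" if "k \<le> m + 4" for k
    using t_mono that by (auto simp: strict_mono_on_def d)
  have d_diff: "d (k + 1) = t (int k + 1) - t (int k)" "d (k + 2) = t (int k + 2) - t (int k + 1)"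
    "d (k + 1) + d (k + 2) = t (int k + 2) - t (int k)" if "k \<le> m + 1" for k
    using that d[of "k + 1"] d[of "k + 2"] by (simp_all add: algebra_simps)

  have Z: "Z u = of_real (1 - w k u) * z k + of_real (w k u) * z (k + 1)" if "k \<le> m" "u \<in> I k" for k u
    unfolding Z_def using mu_curve[OF t_mono, of k u "w k u" z] that
    by (simp add: w_def I_def scaleR_conv_of_real)
  have R: "R u = (1 - w k u) ^ 3 *\<^sub>R c k + (3 * w k u * (1 - w k u) ^ 2) *\<^sub>R r (2 * k + 2)
      + (3 * w k u ^ 2 * (1 - w k u)) *\<^sub>R r (2 * k + 3) + w k u ^ 3 *\<^sub>R c (k + 1)"
    if "k \<le> m" "u \<in> I k" for k u
  proof -
    \<comment> \<open>The weights of \<open>c\<close>, given through \<open>d\<close>, take the knot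
      form used in \<open>rho_curve\<close>.\<close>
    have c': "c k = ((t (int k + 2) - t (int k + 1)) / (t (int k + 2) - t (int k))) *\<^sub>R r (2 * k + 1)
      + ((t (int k + 1) - t (int k)) / (t (int k + 2) - t (int k))) *\<^sub>R r (2 * k + 2)" if "k \<le> m + 1" for k
      using that d_diff[OF that] by (simp only: c scaleR_conv_of_real)
    show ?thesis
      unfolding R_def c'[of k, OF le_trans[OF \<open>k \<le> m\<close> le_add1]] c'[of "k + 1", OF add_le_mono1[OF \<open>k \<le> m\<close>]]
      using that by (intro rho_curve[OF t_mono]) (auto simp: I_def w_def)
  qed

  have deriv_cell: "(R has_vector_derivative Z u ^ 2) (at u within I k)" if k: "k \<le> m" for k u
  proof (cases "u \<in> I k")
    case True
    \<comment> \<open>For \<open>A = d (k + 1)\<close> and \<open>B = d (k + 2)\<close>: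
      \<open>c k\<close> divides the segment from \<open>r (2 * k + 1)\<close> to
      \<open>r (2 * k + 2)\<close> in the ratio \<open>A : B\<close>.\<close>
    have convex: "B / (A + B) * x + A / (A + B) * (x + (A + B) / 3 * y) = x + A / 3 * y"
      if "A + B \<noteq> 0" for A B x y :: complex
    proof -
      define \<alpha> where "\<alpha> = A / (A + B)"
      have A: "A = \<alpha> * (A + B)" and B: "B / (A + B) = 1 - \<alpha>"
        using that by (simp_all add: \<alpha>_def field_simps)
      have "x + A / 3 * y = x + (\<alpha> * (A + B)) / 3 * y"
        by (simp only: A[symmetric])
      also have "\<dots> = (1 - \<alpha>) * x + \<alpha> * (x + (A + B) / 3 * y)"
        by (simp add: algebra_simps)
      finally show ?thesis by (simp only: \<alpha>_def B)
    qed
    have c': "c k = r (2 * k + 1) + of_real (d (k + 1)) / 3 * z k ^ 2" if "k \<le> m + 1" for k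
    proof -
      have "d (k + 1) > 0" "d (k + 2) > 0" using that by (auto intro!: d_pos)
      then have nz: "complex_of_real (d (k + 1)) + of_real (d (k + 2)) \<noteq> 0"
        by (metis add_pos_pos less_irrefl of_real_add of_real_eq_0_iff)
      show ?thesis
        unfolding c[OF that] r_even[OF that] using convex[OF nz] by simp
    qed
    have c_even: "r (2 * k + 2) - c k = of_real (d (k + 2) / 3) * z k ^ 2"
      and c_odd: "c k - r (2 * k + 1) = of_real (d (k + 1) / 3) * z k ^ 2" if "k \<le> m + 1" for k
      unfolding c'[OF that] r_even[OF that] by (simp_all add: field_simps)
    \<comment> \<open>Up to the common factor \<open>d (k + 2) / 3\<close>, the edges of the control
      polygon are the Bezier points of \<open>Z ^ 2\<close>; the factor cancels against
      \<open>3\<close> over the cell length.\<close>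
    have diffs: "r (2 * k + 2) - c k = (d (k + 2) / 3) *\<^sub>R z k ^ 2"
      "r (2 * k + 3) - r (2 * k + 2) = (d (k + 2) / 3) *\<^sub>R (z k * z (k + 1))"
      "c (k + 1) - r (2 * k + 3) = (d (k + 2) / 3) *\<^sub>R z (k + 1) ^ 2"
      using k c_even[of k] c_odd[of "k + 1"] r_odd[OF k]
      by (simp_all add: scaleR_conv_of_real eval_nat_numeral algebra_simps)
    have "d (k + 2) > 0" using k by (intro d_pos) auto
    then have "(3 / (t (int k + 2) - t (int k + 1))) *\<^sub>R ((1 - w k u) ^ 2 *\<^sub>R (r (2 * k + 2) - c k)
      + (2 * w k u * (1 - w k u)) *\<^sub>R (r (2 * k + 3) - r (2 * k + 2)) + w k u ^ 2 *\<^sub>R (c (k + 1) - r (2 * k + 3)))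
      = Z u ^ 2"
      unfolding diffs Z[OF k True] using d_diff(2)[of k, symmetric] k
      by (simp add: scaleR_conv_of_real field_simps power2_eq_square)
    then show ?thesis
      using cubic_Bezier_has_vector_derivative[OF less[OF k], of "c k" "r (2 * k + 2)" "r (2 * k + 3)" "c (k + 1)" u "I k"] True
      by (intro has_vector_derivative_transform[OF True R[OF k]]) (simp_all add: w_def)
  qed (simp add: has_vector_derivative_within_notin_closed I_def)
  have t_mono': "t (int 0 + 1) \<le> t (int n + 2)" if "n \<le> m" for n
    using t_mono that by (intro strict_mono_on_leD[OF t_mono]) auto
  have split: "{t 1..t (int (Suc n) + 2)} = {t 1..t (int n + 2)} \<union> I (Suc n)" if "Suc n \<le> m" for n
    using t_mono'[of n] less[of "Suc n"] that by (auto simp: I_def algebra_simps)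
  \<comment> \<open>Cells are added one at a time; the one-sided derivatives at a shared knot agree,
    since both are \<open>Z u ^ 2\<close>.\<close>
  have deriv: "(R has_vector_derivative Z u ^ 2) (at u within {t 1..t (int n + 2)})" if "n \<le> m" for n u
    using that
  proof (induction n)
    case 0
    then show ?case using deriv_cell[of 0 u] by (simp add: I_def)
  next
    case (Suc n)
    then show ?case
      unfolding split[OF Suc.prems] by (intro has_vector_derivative_within_Un deriv_cell) auto
  qed
  have cell: "\<exists>k\<le>m. u \<in> I k" if "n \<le> m" "u \<in> {t 1..t (int n + 2)}" for n u
    using that
  proof (induction n)
    case 0
    then show ?case by (auto simp: I_def)
  next
    case (Suc n)
    then show ?case unfolding split[OF Suc.prems(1)] by auto
  qed

  show ?thesis
  proof (intro ballI)
    fix u assume u: "u \<in> {t 1..t (int m + 2)}"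
    then obtain k where k: "k \<le> m" "u \<in> I k" using cell[of m u] by auto
    define W where "W = complex_of_real (w k u)"
    define G where "G = bspline_curve (tau_knots m t) 5 (5*m + 19) \<gamma> u"
    define Q where "Q = bspline_curve (tau_knots m t) 5 (5*m + 19) q u"
    \<comment> \<open>Polymorphic, for the real weights and the complex control points
      alike.\<close>
    have tau: "bspline_curve (tau_knots m t) 5 (5*m + 19) f u
      = (\<Sum>l\<le>5. Bernstein 5 l (w k u) *\<^sub>R f (5 * k + 7 + l))" for f :: "nat \<Rightarrow> 'b::real_vector"
      using tau_curve[OF t_mono] k by (auto simp: I_def w_def)
    \<comment> \<open>The last index is written with \<open>k + 1\<close>, so that
      \<open>\<gamma>_7\<close> and \<open>q_7\<close> also supply the right end of the
      cell.\<close>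
    have idx: "5 * k + 7 + 0 = 5 * k + 7" "5 * k + 7 + 1 = 5 * k + 8" "5 * k + 7 + 2 = 5 * k + 9"
      "5 * k + 7 + 3 = 5 * k + 10" "5 * k + 7 + 4 = 5 * k + 11" "5 * k + 7 + 5 = 5 * (k + 1) + 7"
      "2 * (k + 1) + 1 = 2 * k + 3" by simp_all
    have k': "k \<le> m + 1" "k + 1 \<le> m + 1" using k by simp_all
    have Zu: "Z u = (1 - W) * z k + W * z (k + 1)" using Z[OF k] by (simp add: W_def)
    have "complex_of_real G = (1 - W) ^ 2 * of_real (\<sigma> (2 * k + 1)) + 2 * W * (1 - W) * of_real (\<sigma> (2 * k + 2))
        + W ^ 2 * of_real (\<sigma> (2 * k + 3))" (is "_ = ?S")
      unfolding G_def tau sum_Bernstein_5 idx \<gamma>_7[OF k'(1)] \<gamma>_7[OF k'(2)] \<gamma>_8[OF k(1)] \<gamma>_9[OF k(1)]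
        \<gamma>_10[OF k(1)] \<gamma>_11[OF k(1)]
      by (subst Bezier_elevate[symmetric]) (simp add: W_def)
    also have S: "?S = Z u * cnj (Z u)"
      using \<sigma>_odd[OF k'(1)] \<sigma>_odd[OF k'(2)] \<sigma>_even[OF k(1)] unfolding idx Zu
      by (simp add: W_def power2_eq_square algebra_simps)
    finally have G: "complex_of_real G = Z u * cnj (Z u)" .
    have "(1 - W) ^ 2 * p (2 * k + 1) + 2 * W * (1 - W) * p (2 * k + 2) + W ^ 2 * p (2 * k + 3) = Z u ^ 2" (is "?P = _")
      using p_odd[OF k'(1)] p_odd[OF k'(2)] p_even[OF k(1)] unfolding idx Zu
      by (simp add: power2_eq_square algebra_simps)
    moreover have "R u = (1 - W) ^ 3 * c k + 3 * W * (1 - W) ^ 2 * r (2 * k + 2)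
      + 3 * W ^ 2 * (1 - W) * r (2 * k + 3) + W ^ 3 * c (k + 1)"
      unfolding R[OF k] by (simp add: W_def scaleR_conv_of_real)
    \<comment> \<open>The \<open>\<sigma>\<close> terms form the product of \<open>R u\<close> with
      \<open>?S\<close>; the \<open>p\<close> terms are only elevated, hence the instance of
      \<open>Bezier_elevate\<close> at \<open>p\<close>.\<close>
    moreover have "Q = ((1 - W) ^ 3 * c k + 3 * W * (1 - W) ^ 2 * r (2 * k + 2)
      + 3 * W ^ 2 * (1 - W) * r (2 * k + 3) + W ^ 3 * c (k + 1)) * ?S - \<i> * of_real h * ?P"
      unfolding Q_def tau sum_Bernstein_5 idx q_7[OF k'(1)] q_7[OF k'(2)] q_8[OF k(1)] q_9[OF k(1)]
        q_10[OF k(1)] q_11[OF k(1)] Bezier_product[symmetric] Bezier_elevate[of W "p (2 * k + 1)", symmetric]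
      unfolding scaleR_conv_of_real right_diff_distrib distrib_left
      by (simp add: W_def algebra_simps)
    ultimately have Q: "Q = R u * of_real G - \<i> * of_real h * Z u ^ 2" by (simp only: S G)
    have Z0: "Z u \<noteq> 0" using z_nonzero[OF u] by (simp add: Z_def)
    have G': "G = cmod (Z u) ^ 2" using G by (metis complex_norm_square of_real_eq_iff)
    \<comment> \<open>The derivative within an interval is unique because the interval is
      nondegenerate.\<close>
    have "vector_derivative R (at u within {t 1..t (int m + 2)}) = Z u ^ 2"
    proof (rule vector_derivative_within_cbox[of "t 1" "t (int m + 2)", simplified])
      show "t 1 < t (int m + 2)" using t_mono by (auto simp: strict_mono_on_def)
    qed (use u deriv[of m u] in auto)
    \<comment> \<open>The speed \<open>cmod (Z u ^ 2)\<close> equals \<open>G\<close>, so both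
      summands of the offset share the denominator \<open>G\<close>.\<close>
    then have "offset_curve {t 1..t (int m + 2)} R h u = Q / of_real G"
      using Z0 unfolding offset_curve_def Q G' by (simp add: norm_power diff_divide_distrib)
    moreover have "G \<noteq> 0" using G' Z0 by simp
    ultimately show "bspline_curve (tau_knots m t) 5 (5*m + 19) \<gamma> u \<noteq> 0 \<and>
      offset_curve {t 1..t (int m + 2)} (bspline_curve (rho_knots m t) 3 (2*m + 5) r) h u
        = bspline_curve (tau_knots m t) 5 (5*m + 19) q u
          / of_real (bspline_curve (tau_knots m t) 5 (5*m + 19) \<gamma> u)"
      by (simp add: G_def Q_def R_def)
  qed
qed

end
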